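(* Let $n\ge 2$ and let $m\in\{j,p,s\}$. (1) There exists a function $c_m:(0,1)\to(1,\infty)$ such that for every $t\in(0,1)$ and all $x,y\in\mathbb{B}^n$ with $|x|,|y|<t$, $$m_{\mathbb{B}^n}(x,y)\le c_m(t)\, m_{\mathbb{R}^n\setminus\{e_1\}}(x,y).$$ Moreover, $c_m(t)\to 1$ as $t\to 0$ and $c_m(t)\to\infty$ as $t\to 1$. (2) There exists a function $c_m:(0,1)\to(0,\infty)$ such that for every proper subdomain $G\subset\mathbb{R}^n$, every $x\in G$, every $t\in(0,1)$ and all $y,z\in G\setminus \mathbb{B}^n(x,t\,d_G(x))$, $$m_{G\setminus\{x\}}(y,z)\le c_m(t)\, m_G(y,z).$$ Moreover, $c_m(t)\to 2$ as $t\to 1$, and the constant is best possible as $t\to 1$ (the limit value $2$ cannot be replaced by a smaller one).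
   Context: $\mathbb{B}^n(x,r)=\{y\in\mathbb{R}^n:|x-y|<r\}$, $\mathbb{B}^n=\mathbb{B}^n(0,1)$, $e_1=(1,0,\dots,0)$. For a domain $G\subsetneq\mathbb{R}^n$ and $x,y\in G$, with $d_G(x)=d(x,\partial G)$ the Euclidean distance from $x$ to $\partial G$: $$s_G(x,y)=\sup_{z\in\partial G}\frac{|x-y|}{|x-z|+|z-y|},\qquad j_G(x,y)=\log\left(1+\frac{|x-y|}{\min\{d_G(x),d_G(y)\}}\right),$$ $$p_G(x,y)=\frac{|x-y|}{\sqrt{|x-y|^2+4\,d_G(x)\,d_G(y)}}.$$ The notation $m_G$ with $m\in\{j,p,s\}$ means $j_G$, $p_G$ or $s_G$, respectively. *)

theory Defs
  imports "HOL-Analysis.Analysis"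
begin

text \<open>Euclidean distance to the boundary. For a proper nonempty subdomain of \<open>\<real>\<^sup>n\<close> the frontier is
  nonempty, so the convention that \<open>infdist\<close> to the empty set is 0 plays no role.\<close>

definition bdist :: "'a::metric_space set \<Rightarrow> 'a \<Rightarrow> real" where
  "bdist G x = infdist x (frontier G)"

text \<open>If \<open>G\<close> is open, the frontier is nonempty and \<open>x, y \<in> G\<close>, then the denominators below are positive
  and, by the triangle inequality, the supremum is over a nonempty set bounded above by 1.\<close>

definition s_metric :: "'a::metric_space set \<Rightarrow> 'a \<Rightarrow> 'a \<Rightarrow> real" where
  "s_metric G x y = (SUP z\<in>frontier G. dist x y / (dist x z + dist z y))"

definition j_metric :: "'a::metric_space set \<Rightarrow> 'a \<Rightarrow> 'a \<Rightarrow> real" where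
  "j_metric G x y = ln (1 + dist x y / min (bdist G x) (bdist G y))"

definition p_metric :: "'a::metric_space set \<Rightarrow> 'a \<Rightarrow> 'a \<Rightarrow> real" where
  "p_metric G x y = dist x y / sqrt ((dist x y)\<^sup>2 + 4 * bdist G x * bdist G y)"

text \<open>\<open>c\<close>, as a function from \<open>(0,1)\<close> to \<open>(0,\<infinity>)\<close> (values elsewhere are irrelevant), bounds the effect on
  \<open>m\<close> of puncturing a domain, simultaneously for all proper subdomains and all punctures.\<close>

definition puncture_bound ::
    "('a::metric_space set \<Rightarrow> 'a \<Rightarrow> 'a \<Rightarrow> real) \<Rightarrow> (real \<Rightarrow> real) \<Rightarrow> bool" where
  "puncture_bound m c \<longleftrightarrow>
     (\<forall>t\<in>{0<..<1}. 0 < c t) \<and>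
     (\<forall>G. open G \<and> connected G \<and> G \<noteq> {} \<and> G \<noteq> UNIV \<longrightarrow>
       (\<forall>x\<in>G. \<forall>t\<in>{0<..<1}.
         \<forall>y \<in> G - ball x (t * bdist G x). \<forall>z \<in> G - ball x (t * bdist G x).
           m (G - {x}) y z \<le> c t * m G y z))"

end

theory Submission
  imports Defs "HOL-Real_Asymp.Real_Asymp"
begin

text \<open>Apart from \<open>|x - y|\<close>, all three metrics depend on the domain only through the distances of \<open>x\<close>
  and \<open>y\<close> to its boundary points, and they react to those distances at most linearly. This gives one comparison principle
  (\<open>metric_le_if_boundary_dominated\<close>): if every boundary point \<open>z\<close> of \<open>G\<close> is matched by a boundary
  point \<open>w\<close> of \<open>H\<close> that is at most \<open>a\<close> times as far from \<open>x\<close> and from \<open>y\<close> as \<open>z\<close> is, then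
  \<open>m\<^sub>G(x,y) \<le> a m\<^sub>H(x,y)\<close>. Both bounds are instances of it.

  For the unit ball, a boundary point is at distance more than \<open>1 - t\<close> from \<open>x\<close> and \<open>y\<close>, and \<open>e\<^sub>1\<close> is at
  distance less than \<open>1 + t\<close>, so \<open>a = (1 + t) / (1 - t)\<close>. For the puncture at \<open>x\<close>, the boundary points
  of \<open>G\<close> are matched with themselves, and the new boundary point \<open>x\<close> is matched with a point of
  the old boundary nearest to \<open>x\<close>: this lengthens the distances from \<open>y\<close> and \<open>z\<close> by at most \<open>d\<^sub>G(x)\<close>,
  which is at most \<open>1 / t\<close> times their distance to \<open>x\<close>, so \<open>a = 1 + 1 / t\<close>.

  For sharpness, let \<open>e\<close> be a unit vector, puncture \<open>\<real>\<^sup>n - {0}\<close> at \<open>e\<close> and take the points \<open>2e\<close>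
  and \<open>(2 + \<epsilon>)e\<close>. Their distance to \<open>e\<close> is at least \<open>1\<close>, the distance of \<open>e\<close> to \<open>0\<close>, so they stay
  outside the excluded ball for every \<open>t < 1\<close>, and as \<open>\<epsilon> \<rightarrow> 0\<close> the puncture halves their distance to the boundary, from \<open>2\<close> to \<open>1\<close>,
  and so doubles each metric in the limit. Hence every admissible \<open>c\<close> satisfies \<open>c(t) \<ge> 2\<close>.\<close>

section \<open>Comparison of domains by their boundary points\<close>

text \<open>This is Bernoulli's inequality \<open>1 + a r \<le> (1 + r)\<^sup>a\<close> after taking logarithms; here it comes
  from the concavity of the logarithm between \<open>1\<close> and \<open>1 + a r\<close>.\<close>

lemma ln_one_plus_mult_le:
  fixes a r :: real
  assumes "1 \<le> a" "0 \<le> r"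
  shows "ln (1 + a * r) \<le> a * ln (1 + r)"
proof -
  have "(1 - 1/a) * ln 1 + 1/a * ln (1 + a * r) \<le> ln ((1 - 1/a) *\<^sub>R 1 + (1/a) *\<^sub>R (1 + a * r))"
    using assms by (intro concave_onD[OF ln_concave]) (auto intro: add_pos_nonneg)
  also have "(1 - 1/a) *\<^sub>R 1 + (1/a) *\<^sub>R (1 + a * r) = 1 + r"
    using assms by (simp add: field_simps)
  finally show ?thesis
    using assms by (simp add: field_simps)
qed

lemma bdist_pos:
  assumes "frontier G \<noteq> {}" "x \<notin> frontier G"
  shows "0 < bdist G x"
  unfolding bdist_def using assms by (intro infdist_pos_not_in_closed) auto

lemma bdist_le_if_boundary_dominated:
  assumes "0 < a" "frontier G \<noteq> {}"
    and "\<And>z. z \<in> frontier G \<Longrightarrow> \<exists>w\<in>frontier H. dist x w \<le> a * dist x z"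
  shows "bdist H x \<le> a * bdist G x"
proof -
  have "bdist H x / a \<le> dist x z" if z: "z \<in> frontier G" for z
  proof -
    obtain w where "w \<in> frontier H" "dist x w \<le> a * dist x z"
      using assms(3)[OF z] by blast
    then have "bdist H x \<le> a * dist x z"
      unfolding bdist_def by (rule infdist_le2)
    then show ?thesis
      using \<open>0 < a\<close> by (simp add: field_simps)
  qed
  then have "bdist H x / a \<le> bdist G x"
    unfolding bdist_def[of G] infdist_notempty[OF assms(2)]
    using assms(2) by (intro cINF_greatest)
  then show ?thesis
    using \<open>0 < a\<close> by (simp add: field_simps)
qed

lemma j_metric_le_if_bdist_le:
  assumes "1 \<le> a" and pos: "0 < bdist G x" "0 < bdist G y" "0 < bdist H x" "0 < bdist H y"
    and le: "bdist H x \<le> a * bdist G x" "bdist H y \<le> a * bdist G y"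
  shows "j_metric G x y \<le> a * j_metric H x y"
proof -
  define g h where "g = min (bdist G x) (bdist G y)" and "h = min (bdist H x) (bdist H y)"
  have gh: "0 < g" "0 < h" "h \<le> a * g"
    using pos le unfolding g_def h_def by (auto simp: min_def)
  have "dist x y / g \<le> dist x y / (h / a)"
    using gh \<open>1 \<le> a\<close> by (intro divide_left_mono mult_pos_pos) (auto simp: field_simps)
  then have "ln (1 + dist x y / g) \<le> ln (1 + a * (dist x y / h))"
    using gh by (intro ln_mono) (auto simp: field_simps intro: add_pos_nonneg)
  also have "\<dots> \<le> a * ln (1 + dist x y / h)"
    using gh \<open>1 \<le> a\<close> by (intro ln_one_plus_mult_le) auto
  finally show ?thesis
    unfolding j_metric_def g_def h_def .
qed

lemma p_metric_le_if_bdist_le: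
  assumes "1 \<le> a" and pos: "0 < bdist G x" "0 < bdist G y" "0 < bdist H x" "0 < bdist H y"
    and le: "bdist H x \<le> a * bdist G x" "bdist H y \<le> a * bdist G y"
  shows "p_metric G x y \<le> a * p_metric H x y"
proof -
  define S T where "S = (dist x y)\<^sup>2 + 4 * bdist G x * bdist G y"
    and "T = (dist x y)\<^sup>2 + 4 * bdist H x * bdist H y"
  have ST: "0 < S" "0 < T"
    using pos unfolding S_def T_def by (auto intro!: add_nonneg_pos)
  have "bdist H x * bdist H y \<le> (a * bdist G x) * (a * bdist G y)"
    using pos le \<open>1 \<le> a\<close> by (intro mult_mono) auto
  moreover have "1 * (dist x y)\<^sup>2 \<le> a\<^sup>2 * (dist x y)\<^sup>2"
    using \<open>1 \<le> a\<close> by (intro mult_right_mono) auto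
  ultimately have "T \<le> a\<^sup>2 * S"
    unfolding S_def T_def by (simp add: algebra_simps power2_eq_square)
  then have "sqrt T \<le> a * sqrt S"
    using \<open>1 \<le> a\<close> real_sqrt_le_mono[of T "a\<^sup>2 * S"] by (simp add: real_sqrt_mult)
  then have "dist x y * sqrt T \<le> dist x y * (a * sqrt S)"
    by (intro mult_left_mono) auto
  then have "dist x y / sqrt S \<le> a * (dist x y / sqrt T)"
    using ST by (simp add: field_simps)
  then show ?thesis
    unfolding p_metric_def S_def T_def .
qed

lemma s_metric_le_if_boundary_dominated:
  assumes "1 \<le> a" "frontier G \<noteq> {}" "x \<notin> frontier H"
    and dom: "\<And>z. z \<in> frontier G \<Longrightarrow>
      \<exists>w\<in>frontier H. dist x w \<le> a * dist x z \<and> dist y w \<le> a * dist y z"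
  shows "s_metric G x y \<le> a * s_metric H x y"
  unfolding s_metric_def[of G]
proof (rule cSUP_least[OF assms(2)])
  fix z assume "z \<in> frontier G"
  then obtain w where w: "w \<in> frontier H" "dist x w \<le> a * dist x z" "dist y w \<le> a * dist y z"
    using dom by blast
  have bdd: "bdd_above ((\<lambda>w. dist x y / (dist x w + dist w y)) ` frontier H)"
  proof (rule bdd_aboveI2[where M = 1])
    fix w
    show "dist x y / (dist x w + dist w y) \<le> 1"
      by (cases "dist x w + dist w y = 0")
        (auto simp: divide_le_eq_1 dist_triangle order.not_eq_order_implies_strict add_nonneg_nonneg
              intro: add_nonneg_pos)
  qed
  have pos: "0 < dist x w + dist w y"
    using w(1) assms(3) by (intro add_pos_nonneg) auto
  have le: "dist x w + dist w y \<le> a * (dist x z + dist z y)"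
    using w by (simp add: distrib_left dist_commute)
  then have "0 < dist x z + dist z y"
    using pos \<open>1 \<le> a\<close> by (smt (verit) mult_nonneg_nonpos)
  moreover have "dist x y * (dist x w + dist w y) \<le> dist x y * (a * (dist x z + dist z y))"
    using le by (intro mult_left_mono) auto
  ultimately have "dist x y / (dist x z + dist z y) \<le> a * (dist x y / (dist x w + dist w y))"
    using pos by (simp add: pos_divide_le_eq pos_le_divide_eq mult_ac)
  also have "\<dots> \<le> a * s_metric H x y"
    unfolding s_metric_def using w(1) bdd \<open>1 \<le> a\<close> by (intro mult_left_mono cSUP_upper) auto
  finally show "dist x y / (dist x z + dist z y) \<le> a * s_metric H x y" .
qed

text \<open>The principle behind both parts of the theorem. Boundary distances are infima over boundary
  points, so domination of the points gives domination of \<open>bdist\<close>, which is enough for \<open>j\<close> and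
  \<open>p\<close>. For \<open>s\<close> the two distances to the same point enter jointly; this is why a single \<open>w\<close> has to
  serve \<open>x\<close> and \<open>y\<close>.\<close>

lemma metric_le_if_boundary_dominated:
  assumes m: "m \<in> {j_metric, p_metric, s_metric}"
    and a: "1 \<le> a" and ne: "frontier G \<noteq> {}"
    and notin: "x \<notin> frontier G" "y \<notin> frontier G" "x \<notin> frontier H" "y \<notin> frontier H"
    and dom: "\<And>z. z \<in> frontier G \<Longrightarrow>
      \<exists>w\<in>frontier H. dist x w \<le> a * dist x z \<and> dist y w \<le> a * dist y z"
  shows "m G x y \<le> a * m H x y"
proof -
  have neH: "frontier H \<noteq> {}"
    using ne dom by blast
  have pos: "0 < bdist G x" "0 < bdist G y" "0 < bdist H x" "0 < bdist H y"
    using ne neH notin by (auto intro: bdist_pos)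
  have le: "bdist H x \<le> a * bdist G x" "bdist H y \<le> a * bdist G y"
    by (rule bdist_le_if_boundary_dominated; use a ne dom in force)+
  from m consider "m = j_metric" | "m = p_metric" | "m = s_metric"
    by blast
  then show ?thesis
  proof cases
    case 1
    then show ?thesis using j_metric_le_if_bdist_le[OF a pos le] by simp
  next
    case 2
    then show ?thesis using p_metric_le_if_bdist_le[OF a pos le] by simp
  next
    case 3
    then show ?thesis using s_metric_le_if_boundary_dominated[OF a ne notin(3) dom] by simp
  qed
qed

section \<open>The ball and the once-punctured space\<close>

lemma frontier_UNIV_minus_singleton:
  fixes p :: "'a::{perfect_space, t1_space}"
  shows "frontier (UNIV - {p}) = {p}"
proof -
  have "frontier (UNIV - {p}) = frontier {p}"
    by (simp flip: Compl_eq_Diff_UNIV)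
  also have "\<dots> = {p}"
    by (simp add: frontier_def)
  finally show ?thesis .
qed

lemma unit_ball_metric_le:
  fixes e :: "'a::euclidean_space"
  assumes m: "m \<in> {j_metric, p_metric, s_metric}"
    and e: "norm e = 1" and t: "0 < t" "t < 1" and xy: "norm x < t" "norm y < t"
  shows "m (ball 0 1) x y \<le> (1 + t) / (1 - t) * m (UNIV - {e}) x y"
proof (rule metric_le_if_boundary_dominated[OF m])
  have far: "dist u e \<le> (1 + t) / (1 - t) * dist u z" if "norm u < t" "norm z = 1" for u z :: 'a
  proof -
    have "dist u e \<le> 1 + t"
      using norm_triangle_ineq4[of u e] that e by (simp add: dist_norm)
    moreover have "1 - t \<le> dist u z"
      using norm_triangle_ineq3[of u z] that by (simp add: dist_norm)
    then have "(1 + t) / (1 - t) * (1 - t) \<le> (1 + t) / (1 - t) * dist u z"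
      using t by (intro mult_left_mono) auto
    ultimately show ?thesis
      using t by simp
  qed
  show "\<exists>w\<in>frontier (UNIV - {e}). dist x w \<le> (1 + t) / (1 - t) * dist x z
      \<and> dist y w \<le> (1 + t) / (1 - t) * dist y z" if "z \<in> frontier (ball 0 1)" for z
    using that xy far by (simp add: frontier_UNIV_minus_singleton)
  show "1 \<le> (1 + t) / (1 - t)"
    using t by (simp add: field_simps)
  have "e \<in> frontier (ball 0 1)"
    using e by simp
  then show "frontier (ball 0 1 :: 'a set) \<noteq> {}"
    by blast
qed (use t xy e in \<open>auto simp: frontier_UNIV_minus_singleton\<close>)

section \<open>Puncturing a domain\<close>

lemma frontier_puncture_subset: "frontier (G - {x :: 'a::t1_space}) \<subseteq> insert x (frontier G)"
proof -
  have "frontier (G - {x}) \<subseteq> frontier G \<union> frontier {x}"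
    using frontier_Int_subset[of G "- {x}"] by (simp add: Diff_eq)
  then show ?thesis
    by (auto simp: frontier_def)
qed

text \<open>With \<open>w\<close> a boundary point of \<open>G\<close> nearest to the puncture \<open>x\<close>, a point \<open>u\<close> outside the excluded
  ball has \<open>|u - w| \<le> |u - x| + d\<^sub>G(x) \<le> (1 + 1/t) |u - x|\<close>.\<close>

lemma punctured_metric_le:
  fixes G :: "'a::euclidean_space set"
  assumes m: "m \<in> {j_metric, p_metric, s_metric}"
    and G: "open G" "G \<noteq> UNIV" and x: "x \<in> G" and t: "0 < t" "t < 1"
    and y: "y \<in> G - ball x (t * bdist G x)" and z: "z \<in> G - ball x (t * bdist G x)"
  shows "m (G - {x}) y z \<le> (1 + 1 / t) * m G y z"
proof (rule metric_le_if_boundary_dominated[OF m])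
  have disj: "u \<notin> frontier G" if "u \<in> G" for u
    using that G(1) by (simp add: frontier_def interior_open)
  have ne: "frontier G \<noteq> {}"
    using frontier_not_empty[of G] G(2) x by auto
  have dx: "0 < bdist G x"
    using bdist_pos[OF ne disj[OF x]] .
  have yz: "y \<noteq> x" "z \<noteq> x"
    using y z t dx by auto
  show "frontier (G - {x}) \<noteq> {}"
    using y yz by (intro frontier_not_empty) auto
  show "y \<notin> frontier (G - {x})" "z \<notin> frontier (G - {x})"
    using frontier_puncture_subset[of G x] y z yz disj by blast+
  show "y \<notin> frontier G" "z \<notin> frontier G"
    using y z disj by auto
  show "1 \<le> 1 + 1 / t"
    using t by simp
  obtain w where w: "w \<in> frontier G" "infdist x (frontier G) = dist x w"
    using infdist_attains_inf[OF _ ne] by auto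
  have near: "dist u w \<le> (1 + 1 / t) * dist u x" if "u \<in> G - ball x (t * bdist G x)" for u
  proof -
    have "t * dist x w \<le> dist u x"
      using that w(2) by (simp add: bdist_def dist_commute)
    then have "dist x w \<le> 1 / t * dist u x"
      using t by (simp add: field_simps)
    then show ?thesis
      using dist_triangle[of u w x] by (simp add: distrib_right)
  qed
  fix v assume v: "v \<in> frontier (G - {x})"
  show "\<exists>w\<in>frontier G. dist y w \<le> (1 + 1 / t) * dist y v \<and> dist z w \<le> (1 + 1 / t) * dist z v"
  proof (cases "v = x")
    case True
    then show ?thesis
      using w(1) near y z by blast
  next
    case False
    then have "v \<in> frontier G"
      using v frontier_puncture_subset[of G x] by blast
    moreover have "dist u v \<le> (1 + 1 / t) * dist u v" for u
      using t by (simp add: distrib_right)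
    ultimately show ?thesis
      by blast
  qed
qed

lemma puncture_bound_one_plus_inverse:
  fixes m :: "'a::euclidean_space set \<Rightarrow> 'a \<Rightarrow> 'a \<Rightarrow> real"
  assumes "m \<in> {j_metric, p_metric, s_metric}"
  shows "puncture_bound m (\<lambda>t. 1 + 1 / t)"
  unfolding puncture_bound_def
  using punctured_metric_le[OF assms] by (auto intro: add_pos_pos)

section \<open>Sharpness of the constant\<close>

text \<open>For points on a common ray from the puncture, the quantity under the root in \<open>p_metric\<close> is a
  perfect square, \<open>\<epsilon>\<^sup>2 + 4 r (r + \<epsilon>) = (2 r + \<epsilon>)\<^sup>2\<close>, so \<open>p_metric\<close> and \<open>s_metric\<close> agree there.\<close>

lemma radial_metric_values:
  fixes p e :: "'a::euclidean_space"
  assumes e: "norm e = 1" and r: "0 < r" and \<epsilon>: "0 < \<epsilon>"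
  defines "y \<equiv> p + r *\<^sub>R e" and "z \<equiv> p + (r + \<epsilon>) *\<^sub>R e"
  shows "j_metric (UNIV - {p}) y z = ln (1 + \<epsilon> / r)"
    and "p_metric (UNIV - {p}) y z = \<epsilon> / (2 * r + \<epsilon>)"
    and "s_metric (UNIV - {p}) y z = \<epsilon> / (2 * r + \<epsilon>)"
proof -
  have yp: "dist y p = r" "dist z p = r + \<epsilon>"
    using e r \<epsilon> unfolding y_def z_def by (auto simp: dist_norm)
  have "y - z = (- \<epsilon>) *\<^sub>R e"
    unfolding y_def z_def by (simp add: algebra_simps)
  then have yz: "dist y z = \<epsilon>"
    using e \<epsilon> by (simp add: dist_norm)
  have b: "bdist (UNIV - {p}) y = r" "bdist (UNIV - {p}) z = r + \<epsilon>"
    unfolding bdist_def frontier_UNIV_minus_singleton using yp by simp_all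
  show "j_metric (UNIV - {p}) y z = ln (1 + \<epsilon> / r)"
    unfolding j_metric_def b yz using \<epsilon> by simp
  have "\<epsilon>\<^sup>2 + 4 * r * (r + \<epsilon>) = (2 * r + \<epsilon>)\<^sup>2"
    by (simp add: power2_eq_square algebra_simps)
  then show "p_metric (UNIV - {p}) y z = \<epsilon> / (2 * r + \<epsilon>)"
    unfolding p_metric_def b yz using r \<epsilon> by simp
  show "s_metric (UNIV - {p}) y z = \<epsilon> / (2 * r + \<epsilon>)"
    unfolding s_metric_def frontier_UNIV_minus_singleton using yp yz
    by (simp add: dist_commute)
qed

text \<open>Halving the distance to the puncture doubles each metric infinitesimally.\<close>

lemma radial_metric_ratio_tendsto_2:
  fixes e :: "'a::euclidean_space"
  assumes m: "m \<in> {j_metric, p_metric, s_metric}" and e: "norm e = 1"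
  shows "((\<lambda>\<epsilon>. m (UNIV - {e}) (2 *\<^sub>R e) ((2 + \<epsilon>) *\<^sub>R e) / m (UNIV - {0}) (2 *\<^sub>R e) ((2 + \<epsilon>) *\<^sub>R e))
    \<longlongrightarrow> 2) (at_right 0)" (is "(?f \<longlongrightarrow> 2) _")
proof -
  have shift: "e + 1 *\<^sub>R e = 2 *\<^sub>R e" "e + (1 + \<epsilon>) *\<^sub>R e = (2 + \<epsilon>) *\<^sub>R e" for \<epsilon>
    by (simp_all add: scaleR_left_distrib scaleR_2)
  note values_e = radial_metric_values[OF e, of 1 _ e, unfolded shift]
  note values_0 = radial_metric_values[OF e, of 2 _ 0, unfolded add_0]
  have pos: "eventually (\<lambda>\<epsilon>::real. 0 < \<epsilon>) (at_right 0)"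
    by (rule eventually_at_right_less)
  from m consider "m = j_metric" | "m = p_metric \<or> m = s_metric"
    by blast
  then show ?thesis
  proof cases
    case 1
    have "((\<lambda>\<epsilon>::real. ln (1 + \<epsilon> / 1) / ln (1 + \<epsilon> / 2)) \<longlongrightarrow> 2) (at_right 0)"
      by real_asymp
    moreover have "eventually (\<lambda>\<epsilon>. ln (1 + \<epsilon> / 1) / ln (1 + \<epsilon> / 2) = ?f \<epsilon>) (at_right 0)"
      using pos by eventually_elim (simp only: 1 values_e(1) values_0(1) zero_less_one zero_less_numeral)
    ultimately show ?thesis
      by (rule Lim_transform_eventually)
  next
    case 2
    have "((\<lambda>\<epsilon>::real. (\<epsilon> / (2 * 1 + \<epsilon>)) / (\<epsilon> / (2 * 2 + \<epsilon>))) \<longlongrightarrow> 2) (at_right 0)"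
      by real_asymp
    moreover have "eventually (\<lambda>\<epsilon>. (\<epsilon> / (2 * 1 + \<epsilon>)) / (\<epsilon> / (2 * 2 + \<epsilon>)) = ?f \<epsilon>) (at_right 0)"
      using pos
    proof eventually_elim
      case (elim \<epsilon>)
      show ?case
        using 2
        by (elim disjE)
          (simp_all only: values_e[OF _ elim] values_0[OF _ elim] zero_less_one zero_less_numeral)
    qed
    ultimately show ?thesis
      by (rule Lim_transform_eventually)
  qed
qed

lemma radial_metric_pos:
  fixes e :: "'a::euclidean_space"
  assumes m: "m \<in> {j_metric, p_metric, s_metric}" and e: "norm e = 1" and \<epsilon>: "0 < \<epsilon>"
  shows "0 < m (UNIV - {0}) (2 *\<^sub>R e) ((2 + \<epsilon>) *\<^sub>R e)"
proof -
  note v = radial_metric_values[OF e _ \<epsilon>, of 2 0, unfolded add_0]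
  show ?thesis
    using m \<epsilon> by (auto simp: v)
qed

text \<open>Discarding the boundary point \<open>0\<close> of the twice-punctured space only decreases the metric, so
  the once-punctured space \<open>\<real>\<^sup>n - {e}\<close>, where the values are explicit, can stand in for it.\<close>

lemma puncture_bound_ge_2:
  fixes m :: "'a::euclidean_space set \<Rightarrow> 'a \<Rightarrow> 'a \<Rightarrow> real"
  assumes m: "m \<in> {j_metric, p_metric, s_metric}" and dim: "2 \<le> DIM('a)"
    and c: "puncture_bound m c" and t: "0 < t" "t < 1"
  shows "2 \<le> c t"
proof -
  obtain e :: 'a where e: "norm e = 1"
    using vector_choose_size[of 1] by auto
  then have e0: "e \<noteq> 0"
    by auto
  let ?y = "2 *\<^sub>R e" and ?z = "\<lambda>\<epsilon>::real. (2 + \<epsilon>) *\<^sub>R e"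
  have G: "open (UNIV - {0::'a})" "connected (UNIV - {0::'a})" "UNIV - {0::'a} \<noteq> {}"
      "UNIV - {0::'a} \<noteq> UNIV"
    using connected_punctured_universe[OF dim, of 0] e0
    by (auto simp: Compl_eq_Diff_UNIV[symmetric])
  have "UNIV - {0} - {e} = - {0, e}"
    by auto
  then have "frontier (UNIV - {0} - {e}) = frontier {0, e}"
    by simp
  then have fr: "frontier (UNIV - {0} - {e}) = {0, e}"
    by (simp add: frontier_def[of "{0, e}"] closure_closed empty_interior_finite)
  have b: "bdist (UNIV - {0}) e = 1"
    unfolding bdist_def frontier_UNIV_minus_singleton using e by simp
  have "m (UNIV - {e}) ?y (?z \<epsilon>) / m (UNIV - {0}) ?y (?z \<epsilon>) \<le> c t" if \<epsilon>: "0 < \<epsilon>" for \<epsilon>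
  proof -
    have ne: "?y \<noteq> e" "?z \<epsilon> \<noteq> e" "?y \<noteq> 0" "?z \<epsilon> \<noteq> 0"
      using e0 \<epsilon> scaleR_cancel_right[of 2 e 1] scaleR_cancel_right[of "2 + \<epsilon>" e 1] by auto
    have "dist e ?y = 1" "dist e (?z \<epsilon>) = 1 + \<epsilon>"
    proof -
      have "e - ?y = (- 1) *\<^sub>R e" "e - ?z \<epsilon> = (- (1 + \<epsilon>)) *\<^sub>R e"
        by (simp_all add: algebra_simps scaleR_2)
      then show "dist e ?y = 1" "dist e (?z \<epsilon>) = 1 + \<epsilon>"
        unfolding dist_norm using e \<epsilon> by simp_all
    qed
    then have outside: "?y \<in> UNIV - {0} - ball e (t * bdist (UNIV - {0}) e)"
        "?z \<epsilon> \<in> UNIV - {0} - ball e (t * bdist (UNIV - {0}) e)"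
      using ne \<epsilon> t by (auto simp: b)
    have "m (UNIV - {e}) ?y (?z \<epsilon>) \<le> 1 * m (UNIV - {0} - {e}) ?y (?z \<epsilon>)"
      using ne
      by (intro metric_le_if_boundary_dominated[OF m]) (auto simp: frontier_UNIV_minus_singleton fr)
    also have "\<dots> \<le> c t * m (UNIV - {0}) ?y (?z \<epsilon>)"
      using c G outside t e0 unfolding puncture_bound_def by simp
    finally show ?thesis
      using radial_metric_pos[OF m e \<epsilon>] by (simp add: pos_divide_le_eq)
  qed
  then have "eventually (\<lambda>\<epsilon>. m (UNIV - {e}) ?y (?z \<epsilon>) / m (UNIV - {0}) ?y (?z \<epsilon>) \<le> c t)
      (at_right 0)"
    using eventually_at_right_less[of "0::real"] by (auto elim: eventually_mono)
  then show ?thesis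
    using tendsto_upperbound[OF radial_metric_ratio_tendsto_2[OF m e]] by simp
qed

section \<open>Bounds for the ball and for punctured domains\<close>

theorem theorem1p8:
  fixes m :: "(real ^ 'n) set \<Rightarrow> real ^ 'n \<Rightarrow> real ^ 'n \<Rightarrow> real"
    and i1 :: 'n
  assumes "CARD('n) \<ge> 2"
    and "m \<in> {j_metric, p_metric, s_metric}"
  shows
    "(\<exists>c :: real \<Rightarrow> real.
        (\<forall>t\<in>{0<..<1}. 1 < c t) \<and>
        (\<forall>t\<in>{0<..<1}. \<forall>x\<in>ball 0 1. \<forall>y\<in>ball 0 1. norm x < t \<and> norm y < t \<longrightarrow>
           m (ball 0 1) x y \<le> c t * m (UNIV - {axis i1 1}) x y) \<and>
        (c \<longlongrightarrow> 1) (at_right 0) \<and>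
        filterlim c at_top (at_left 1))
     \<and>
     (\<exists>c :: real \<Rightarrow> real.
        puncture_bound m c \<and>
        (c \<longlongrightarrow> 2) (at_left 1) \<and>
        (\<forall>c' L. puncture_bound m c' \<and> (c' \<longlongrightarrow> L) (at_left 1) \<longrightarrow> 2 \<le> L))"
proof (intro conjI)
  let ?c = "\<lambda>t::real. (1 + t) / (1 - t)"
  have "1 < ?c t" if "t \<in> {0<..<1}" for t
    using that by (simp add: field_simps)
  moreover have "m (ball 0 1) x y \<le> ?c t * m (UNIV - {axis i1 1}) x y"
    if "t \<in> {0<..<1}" "norm x < t" "norm y < t" for t x y
    using that by (intro unit_ball_metric_le[OF assms(2)]) auto
  moreover have "(?c \<longlongrightarrow> 1) (at_right 0)"
    by real_asymp
  moreover have "filterlim ?c at_top (at_left 1)"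
    by real_asymp
  ultimately show "\<exists>c. (\<forall>t\<in>{0<..<1}. 1 < c t) \<and>
        (\<forall>t\<in>{0<..<1}. \<forall>x\<in>ball 0 1. \<forall>y\<in>ball 0 1. norm x < t \<and> norm y < t \<longrightarrow>
           m (ball 0 1) x y \<le> c t * m (UNIV - {axis i1 1}) x y) \<and>
        (c \<longlongrightarrow> 1) (at_right 0) \<and> filterlim c at_top (at_left 1)"
    by (intro exI[of _ ?c]) blast
next
  have "((\<lambda>t::real. 1 + 1 / t) \<longlongrightarrow> 2) (at_left 1)"
    by real_asymp
  moreover have "2 \<le> L" if "puncture_bound m c'" "(c' \<longlongrightarrow> L) (at_left 1)" for c' L
  proof -
    have "eventually (\<lambda>t::real. t \<in> {0<..<1}) (at_left 1)"
      by (rule eventually_at_left_real) simp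
    then have "eventually (\<lambda>t. 2 \<le> c' t) (at_left 1)"
      by eventually_elim (use puncture_bound_ge_2[OF assms(2) _ that(1)] assms(1) in auto)
    then show ?thesis
      using tendsto_lowerbound[OF that(2)] by simp
  qed
  ultimately show "\<exists>c. puncture_bound m c \<and> (c \<longlongrightarrow> 2) (at_left 1) \<and>
        (\<forall>c' L. puncture_bound m c' \<and> (c' \<longlongrightarrow> L) (at_left 1) \<longrightarrow> 2 \<le> L)"
    using puncture_bound_one_plus_inverse[OF assms(2)] by blast
qed

end
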